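(* Let $(G,\varepsilon)$ be an edge-weighted multigraph on $n$ vertices and let $\sim$ be an equivalence relation on its vertex set, with $n-k$ equivalence classes. Let $\lambda_1\le\dots\le\lambda_n$ and $\mu_1\le\dots\le\mu_{n-k}$ denote the combinatorial Laplacian eigenvalues (with multiplicity) of $(G,\varepsilon)$ and $(G/\sim,\varepsilon)$, respectively. Let $q$ be the number of equivalence classes of $\sim$ with more than one element. Then $$\lambda_i\le\mu_i\le\lambda_{i+q+k}$$ for all $1\le i\le n-k$, where the inequality $\mu_i\le\lambda_{i+q+k}$ is asserted only when $\lambda_{i+q+k}$ is defined, i.e. when $i+q+k\le n$.
   Context: A graph is a finite multigraph with vertex set $V$ and edge set $E$ (loops and multiple edges allowed). An edge-weighted multigraph $(G,\varepsilon)$ is a graph with edge weights $\varepsilon:E\to\mathbb R_{>0}$. For $u,v\in V$, $\varepsilon(u,v)$ is the total edge weight between $u$ and $v$, with loops counted twice, and $d_{(G,\varepsilon)}(u)=\sum_{v\in V}\varepsilon(u,v)$. The combinatorial Laplacian is the real symmetric $V\times V$ matrix $L_{(G,\varepsilon)}=D_{(G,\varepsilon)}-A_{(G,\varepsilon)}$, where $A_{(G,\varepsilon)}=(\varepsilon(u,v))_{u,v}$ and $D_{(G,\varepsilon)}$ is diagonal with entries $d_{(G,\varepsilon)}(v)$. The quotient graph $G/\sim$ is obtained from $G$ by identifying the vertices in each equivalence class; its edges are the edges of $G$ (some possibly becoming loops or parallel edges), with the same edge weights. *)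

theory Defs
  imports
    Complex_Main
    "HOL-Library.Uprod"
    "HOL-Library.Multiset"
    "Jordan_Normal_Form.Char_Poly"
begin

section \<open>Edge-weighted multigraphs and quotients\<close>

text \<open>
  The edges form an arbitrary set and the function \<open>ends\<close> sends each of them to its unordered
  pair of end points. Parallel edges are distinct elements with equal \<open>ends\<close>; an edge \<open>e\<close> with
  \<open>ends G e = Upair v v\<close> is a loop at \<open>v\<close>.
\<close>

record ('v, 'e) multigraph =
  verts :: "'v set"
  edges :: "'e set"
  ends :: "'e \<Rightarrow> 'v uprod"

definition finite_multigraph :: "('v, 'e) multigraph \<Rightarrow> bool" where
  "finite_multigraph G \<longleftrightarrow>
     finite (verts G) \<and> finite (edges G) \<and> (\<forall>e\<in>edges G. set_uprod (ends G e) \<subseteq> verts G)"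

definition weighted_multigraph :: "('v, 'e) multigraph \<Rightarrow> ('e \<Rightarrow> real) \<Rightarrow> bool" where
  "weighted_multigraph G \<epsilon> \<longleftrightarrow> finite_multigraph G \<and> (\<forall>e\<in>edges G. 0 < \<epsilon> e)"

text \<open>The vertices of the quotient are the equivalence classes; the edges are unchanged.\<close>

definition quotient_multigraph ::
    "('v, 'e) multigraph \<Rightarrow> ('v \<times> 'v) set \<Rightarrow> ('v set, 'e) multigraph" where
  "quotient_multigraph G r =
     \<lparr> verts = verts G // r,
       edges = edges G,
       ends = (\<lambda>e. map_uprod (\<lambda>v. r `` {v}) (ends G e)) \<rparr>"


section \<open>The combinatorial Laplacian\<close>

definition weight_between ::
    "('v, 'e) multigraph \<Rightarrow> ('e \<Rightarrow> real) \<Rightarrow> 'v \<Rightarrow> 'v \<Rightarrow> real" where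
  "weight_between G \<epsilon> u v =
     (\<Sum>e | e \<in> edges G \<and> ends G e = Upair u v. if u = v then 2 * \<epsilon> e else \<epsilon> e)"

definition weighted_degree :: "('v, 'e) multigraph \<Rightarrow> ('e \<Rightarrow> real) \<Rightarrow> 'v \<Rightarrow> real" where
  "weighted_degree G \<epsilon> u = (\<Sum>v\<in>verts G. weight_between G \<epsilon> u v)"

definition laplacian :: "('v, 'e) multigraph \<Rightarrow> ('e \<Rightarrow> real) \<Rightarrow> 'v \<Rightarrow> 'v \<Rightarrow> real" where
  "laplacian G \<epsilon> u v = (if u = v then weighted_degree G \<epsilon> u else 0) - weight_between G \<epsilon> u v"


section \<open>Eigenvalues\<close>

text \<open>
  A matrix with rows and columns indexed by a finite set is turned into a matrix indexed by
  natural numbers through a list enumerating that set. By the lemma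
  \<open>char_poly_matrix_wrt_indep\<close> below, the characteristic polynomial, and hence the list of
  eigenvalues, does not depend on the enumeration.
\<close>

definition matrix_wrt :: "'v list \<Rightarrow> ('v \<Rightarrow> 'v \<Rightarrow> real) \<Rightarrow> real mat" where
  "matrix_wrt vs M = mat (length vs) (length vs) (\<lambda>(i, j). M (vs ! i) (vs ! j))"

definition laplacian_mat :: "('v, 'e) multigraph \<Rightarrow> ('e \<Rightarrow> real) \<Rightarrow> real mat" where
  "laplacian_mat G \<epsilon> =
     matrix_wrt (SOME vs. distinct vs \<and> set vs = verts G) (laplacian G \<epsilon>)"

text \<open>
  The real eigenvalues in weakly increasing order, repeated according to algebraic multiplicity.
  For a real symmetric matrix these are all eigenvalues, see \<open>length_sorted_eigenvalues\<close> below.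
\<close>

definition sorted_eigenvalues :: "real mat \<Rightarrow> real list" where
  "sorted_eigenvalues A = sorted_list_of_multiset (proots (char_poly A))"

text \<open>The \<open>i\<close>-th smallest eigenvalue, where \<open>i\<close> starts at 1.\<close>

definition laplacian_eigenvalue ::
    "('v, 'e) multigraph \<Rightarrow> ('e \<Rightarrow> real) \<Rightarrow> nat \<Rightarrow> real" where
  "laplacian_eigenvalue G \<epsilon> i = sorted_eigenvalues (laplacian_mat G \<epsilon>) ! (i - 1)"


section \<open>The eigenvalues are well defined\<close>

lemma matrix_wrt_carrier [simp]: "matrix_wrt vs M \<in> carrier_mat (length vs) (length vs)"
  by (simp add: matrix_wrt_def)

lemma char_poly_matrix_wrt_indep:
  assumes "distinct vs" "distinct ws" "set vs = set ws"
  shows "char_poly (matrix_wrt vs M) = char_poly (matrix_wrt ws M)"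
proof (rule char_poly_similar)
  let ?n = "length vs"
  have len: "length ws = ?n"
    using assms by (metis distinct_card)
  define pm :: "'a list \<Rightarrow> 'a list \<Rightarrow> real mat" where
    "pm xs ys = mat ?n ?n (\<lambda>(i, j). of_bool (xs ! i = ys ! j))" for xs ys
  have sum_nth: "(\<Sum>j<?n. f (xs ! j)) = (\<Sum>x\<in>set vs. f x)"
    if "xs \<in> {vs, ws}" for xs and f :: "'a \<Rightarrow> real"
  proof -
    have "distinct xs" "set xs = set vs" "length xs = ?n" using that assms len by auto
    then show ?thesis
      by (metis bij_betw_nth sum.reindex_bij_betw)
  qed
  have mem: "xs ! i \<in> set vs" if "xs \<in> {vs, ws}" "i < ?n" for xs i
    using that assms(3) len by (metis empty_iff insert_iff nth_mem)
  have sel: "(\<Sum>x\<in>set vs. of_bool (a = x) * f x) = f a"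
            "(\<Sum>x\<in>set vs. f x * of_bool (x = a)) = f a"
    if "a \<in> set vs" for a and f :: "'a \<Rightarrow> real"
  proof -
    have "(\<Sum>x\<in>set vs. of_bool (a = x) * f x) = (\<Sum>x\<in>set vs. if x = a then f x else 0)"
         "(\<Sum>x\<in>set vs. f x * of_bool (x = a)) = (\<Sum>x\<in>set vs. if x = a then f x else 0)"
      by (intro sum.cong refl; simp)+
    then show "(\<Sum>x\<in>set vs. of_bool (a = x) * f x) = f a"
              "(\<Sum>x\<in>set vs. f x * of_bool (x = a)) = f a"
      using that by simp_all
  qed
  have one: "pm xs ys * pm ys xs = 1\<^sub>m ?n"
    if "xs \<in> {vs, ws}" "ys \<in> {vs, ws}" for xs ys
  proof (rule eq_matI)
    fix i j assume "i < dim_row (1\<^sub>m ?n :: real mat)" "j < dim_col (1\<^sub>m ?n :: real mat)"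
    then have ij: "i < ?n" "j < ?n" by auto
    have "distinct xs" "length xs = ?n" using that assms len by auto
    then have eq: "xs ! i = xs ! j \<longleftrightarrow> i = j" using ij by (simp add: nth_eq_iff_index_eq)
    have "(pm xs ys * pm ys xs) $$ (i, j) =
            (\<Sum>l<?n. of_bool (xs ! i = ys ! l) * of_bool (ys ! l = xs ! j))"
      using ij by (simp add: pm_def scalar_prod_def atLeast0LessThan)
    also have "\<dots> = of_bool (xs ! i = xs ! j)"
      using sum_nth[OF that(2), of "\<lambda>y. of_bool (xs ! i = y) * of_bool (y = xs ! j)"]
            sel(1)[OF mem[OF that(1) ij(1)], of "\<lambda>y. of_bool (y = xs ! j)"] by simp
    finally show "(pm xs ys * pm ys xs) $$ (i, j) = 1\<^sub>m ?n $$ (i, j)"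
      using ij eq by simp
  qed (simp_all add: pm_def)
  have conj: "matrix_wrt vs M = pm vs ws * matrix_wrt ws M * pm ws vs"
  proof (rule eq_matI)
    fix i j assume "i < dim_row (pm vs ws * matrix_wrt ws M * pm ws vs)"
                   "j < dim_col (pm vs ws * matrix_wrt ws M * pm ws vs)"
    then have ij: "i < ?n" "j < ?n" by (auto simp: pm_def)
    have left: "(pm vs ws * matrix_wrt ws M) $$ (i, l) = M (vs ! i) (ws ! l)" if l: "l < ?n" for l
    proof -
      have "(pm vs ws * matrix_wrt ws M) $$ (i, l) =
              (\<Sum>m<?n. of_bool (vs ! i = ws ! m) * M (ws ! m) (ws ! l))"
        using ij l len by (simp add: pm_def matrix_wrt_def scalar_prod_def atLeast0LessThan)
      also have "\<dots> = M (vs ! i) (ws ! l)"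
        using sum_nth[of ws "\<lambda>y. of_bool (vs ! i = y) * M y (ws ! l)"]
              sel(1)[OF mem[of vs i], of "\<lambda>y. M y (ws ! l)"] ij by simp
      finally show ?thesis .
    qed
    have "(pm vs ws * matrix_wrt ws M * pm ws vs) $$ (i, j) =
            (\<Sum>l<?n. (pm vs ws * matrix_wrt ws M) $$ (i, l) * of_bool (ws ! l = vs ! j))"
      using ij len by (simp add: pm_def matrix_wrt_def scalar_prod_def atLeast0LessThan)
    also have "\<dots> = (\<Sum>l<?n. M (vs ! i) (ws ! l) * of_bool (ws ! l = vs ! j))"
      using left by simp
    also have "\<dots> = M (vs ! i) (vs ! j)"
      using sum_nth[of ws "\<lambda>y. M (vs ! i) y * of_bool (y = vs ! j)"]
            sel(2)[OF mem[of vs j], of "\<lambda>y. M (vs ! i) y"] ij by simp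
    finally show "matrix_wrt vs M $$ (i, j) = (pm vs ws * matrix_wrt ws M * pm ws vs) $$ (i, j)"
      using ij by (simp add: matrix_wrt_def)
  qed (simp_all add: pm_def matrix_wrt_def)
  show "similar_mat (matrix_wrt vs M) (matrix_wrt ws M)"
  proof (rule similar_matI[where n = ?n and P = "pm vs ws" and Q = "pm ws vs"])
    show "{matrix_wrt vs M, matrix_wrt ws M, pm vs ws, pm ws vs} \<subseteq> carrier_mat ?n ?n"
      using len by (simp add: pm_def matrix_wrt_def)
  qed (use one in simp, use one in simp, fact conj)
qed

lemma symmetric_eigenvalue_real:
  fixes A :: "real mat"
  assumes A: "A \<in> carrier_mat n n"
    and sym: "\<And>i j. i < n \<Longrightarrow> j < n \<Longrightarrow> A $$ (i, j) = A $$ (j, i)"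
    and ev: "eigenvalue (map_mat complex_of_real A) a"
  shows "a \<in> \<real>"
proof -
  let ?B = "map_mat complex_of_real A"
  obtain v where v: "v \<in> carrier_vec n" "v \<noteq> 0\<^sub>v n" "?B *\<^sub>v v = a \<cdot>\<^sub>v v"
    using ev A unfolding eigenvalue_def eigenvector_def by auto
  have row: "(\<Sum>j<n. complex_of_real (A $$ (i, j)) * v $ j) = a * v $ i" if "i < n" for i
  proof -
    have "(?B *\<^sub>v v) $ i = (\<Sum>j<n. complex_of_real (A $$ (i, j)) * v $ j)"
      using that A v(1) by (simp add: scalar_prod_def atLeast0LessThan)
    then show ?thesis using v that by simp
  qed
  define S where "S = (\<Sum>i<n. \<Sum>j<n. cnj (v $ i) * (complex_of_real (A $$ (i, j)) * v $ j))"
  define N where "N = (\<Sum>i<n. cnj (v $ i) * v $ i)"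
  have S: "S = a * N"
    unfolding S_def N_def sum_distrib_left[symmetric] using row
    by (simp add: sum_distrib_left algebra_simps)
  have "cnj S = (\<Sum>i<n. \<Sum>j<n. cnj (v $ j) * (complex_of_real (A $$ (j, i)) * v $ i))"
    unfolding S_def using sym by (simp add: algebra_simps)
  also have "\<dots> = S"
    unfolding S_def by (rule sum.swap)
  finally have "cnj S = S" .
  moreover have "cnj N = N"
    unfolding N_def by (simp add: mult.commute)
  moreover have "N \<noteq> 0"
  proof -
    have N: "N = complex_of_real (\<Sum>i<n. (cmod (v $ i))\<^sup>2)"
      unfolding N_def of_real_sum
      by (intro sum.cong refl) (metis complex_norm_square mult.commute of_real_power)
    have "\<exists>i<n. v $ i \<noteq> 0"
      using v(1,2) by (metis carrier_vecD eq_vecI index_zero_vec(1) index_zero_vec(2))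
    then have "(\<Sum>i<n. (cmod (v $ i))\<^sup>2) \<noteq> 0"
      by (subst sum_nonneg_eq_0_iff) auto
    then show ?thesis unfolding N using of_real_eq_0_iff by blast
  qed
  ultimately have "cnj a = a"
    using S by auto
  then show ?thesis
    by (simp add: complex_is_Real_iff complex_eq_iff)
qed

lemma length_sorted_eigenvalues:
  fixes A :: "real mat"
  assumes A: "A \<in> carrier_mat n n"
    and sym: "\<And>i j. i < n \<Longrightarrow> j < n \<Longrightarrow> A $$ (i, j) = A $$ (j, i)"
  shows "length (sorted_eigenvalues A) = n"
proof -
  let ?B = "map_mat complex_of_real A"
  have B: "?B \<in> carrier_mat n n" using A by simp
  obtain as where as: "char_poly ?B = (\<Prod>a\<leftarrow>as. [:- a, 1:])" "length as = n"
    using char_poly_factorized[OF B] by blast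
  have real: "complex_of_real (Re a) = a" if "a \<in> set as" for a
  proof -
    have "eigenvalue ?B a"
      using that linear_poly_root[of a as] as(1) eigenvalue_root_char_poly[OF B] by simp
    then show ?thesis
      using symmetric_eigenvalue_real[OF A sym] by (simp add: of_real_Re)
  qed
  interpret inj_comm_ring_hom complex_of_real
    by unfold_locales auto
  interpret ph: map_poly_inj_comm_ring_hom complex_of_real ..
  have "char_poly ?B = map_poly complex_of_real (char_poly A)"
    by (rule of_real_hom.char_poly_hom[OF A])
  then have "map_poly complex_of_real (char_poly A) = (\<Prod>a\<leftarrow>as. [:- a, 1:])"
    using as(1) by (simp only:)
  also have "\<dots> = map_poly complex_of_real (\<Prod>a\<leftarrow>map Re as. [:- a, 1:])"
    using real
  proof (induction as)
    case (Cons a as)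
    have "[:- a, 1:] = map_poly complex_of_real [:- Re a, 1:]"
      using Cons.prems by simp
    then show ?case
      using Cons by (simp add: ph.hom_mult del: mult_pCons_left)
  qed simp
  finally have "char_poly A = (\<Prod>a\<leftarrow>map Re as. [:- a, 1:])"
    by (simp only: ph.eq_iff)
  moreover have "size (proots (\<Prod>a\<leftarrow>bs. [:- a, 1:])) = length bs" for bs :: "real list"
  proof (induction bs)
    case (Cons b bs)
    have "(\<Prod>a\<leftarrow>bs. [:- a, 1:]) \<noteq> 0"
      by (auto simp: prod_list_zero_iff)
    then show ?case using Cons by (simp add: proots_mult del: mult_pCons_left)
  qed simp
  ultimately have "size (proots (char_poly A)) = n"
    using as(2) by (metis length_map)
  then show ?thesis
    by (metis mset_sorted_list_of_multiset size_mset sorted_eigenvalues_def)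
qed

lemma laplacian_sym: "laplacian G \<epsilon> u v = laplacian G \<epsilon> v u"
proof -
  have "Upair u v = Upair v u" by simp
  then have "weight_between G \<epsilon> u v = weight_between G \<epsilon> v u"
    unfolding weight_between_def by (simp only: eq_commute[of u v])
  then show ?thesis by (simp add: laplacian_def)
qed

lemma length_laplacian_eigenvalues:
  assumes "finite (verts G)"
  shows "length (sorted_eigenvalues (laplacian_mat G \<epsilon>)) = card (verts G)"
proof -
  define vs where "vs = (SOME vs. distinct vs \<and> set vs = verts G)"
  have vs: "distinct vs \<and> set vs = verts G"
    unfolding vs_def by (rule someI_ex) (use finite_distinct_list[OF assms] in blast)
  then have "length vs = card (verts G)"
    using distinct_card by metis
  moreover have "length (sorted_eigenvalues (matrix_wrt vs (laplacian G \<epsilon>))) = length vs"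
    by (rule length_sorted_eigenvalues) (auto simp: matrix_wrt_def intro: laplacian_sym)
  ultimately show ?thesis
    by (simp add: laplacian_mat_def vs_def)
qed

lemma finite_multigraph_quotient:
  assumes "finite_multigraph G" "equiv (verts G) r"
  shows "finite_multigraph (quotient_multigraph G r)"
  using assms
  by (auto simp: finite_multigraph_def quotient_multigraph_def uprod.set_map
      intro!: quotientI finite_quotient equiv_type)

end

theory Submission
  imports Defs
begin

text \<open>
  The quadratic form of a Laplacian is the energy \<open>\<Sum>e. \<epsilon> e * (f a - f b)\<^sup>2\<close>, where \<open>a\<close> and
  \<open>b\<close> are the end points of \<open>e\<close>. A function on the classes and its pull-back to the vertices
  therefore have the same energy (\<open>quadratic_form_laplacian_pullback\<close>); only the norms differ,
  since the pull-back counts each class as often as it has elements.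

  Both inequalities follow from the min-max principle, in the form of the comparison theorem
  \<open>sorted_eigenvalues_comparison\<close>: if a linear map does not decrease norms and does not increase
  energies on a subspace cut out by \<open>h\<close> linear equations, and energies are nonnegative on its source,
  then the \<open>i\<close>-th eigenvalue of its target is at most the \<open>(i + h)\<close>-th eigenvalue of its source.

  For \<open>\<lambda>\<^sub>i \<le> \<mu>\<^sub>i\<close> the map is the pull-back and \<open>h = 0\<close>. For \<open>\<mu>\<^sub>i \<le> \<lambda>\<^sub>i\<^sub>+\<^sub>q\<^sub>+\<^sub>k\<close> consider
  the functions on the vertices that vanish on every class with more than one element. They are
  constant on classes, so they descend to the quotient with the same energy, and also with the same
  norm, as the only classes that carry a nonzero value are singletons. The number of equations is
  the number of vertices in nontrivial classes. A class with \<open>c\<close> elements costs \<open>c - 1\<close> vertices in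
  the quotient, so this number is \<open>k + q\<close> (\<open>card_union_nontrivial_classes\<close>).

  The comparison theorem rests on the spectral theorem for real symmetric matrices
  (\<open>real_symmetric_orthogonally_diagonalizable\<close>) and on the fact that fewer homogeneous linear
  equations than unknowns have a nontrivial solution.
\<close>

section \<open>The spectral theorem for real symmetric matrices\<close>

lemma monic_split_eq_prod_proots:
  fixes p :: "'a::field poly"
  assumes "monic p" "size (proots p) = degree p"
  shows "p = (\<Prod>a\<in>#proots p. [:- a, 1:])"
  using assms
proof (induction "degree p" arbitrary: p)
  case 0
  then have "p = 1" using monic_degree_0[of p] by simp
  then show ?case by simp
next
  case (Suc d)
  then obtain a where "a \<in># proots p"
    by (metis multiset_nonemptyE nat.distinct(1) size_empty)
  moreover have "p \<noteq> 0" using Suc.prems by auto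
  ultimately obtain s where s: "p = [:- a, 1:] * s"
    by (auto simp: poly_eq_0_iff_dvd elim: dvdE)
  have s0: "s \<noteq> 0" "monic s" using s Suc.prems by (auto simp: lead_coeff_mult simp del: mult_pCons_left)
  have pr: "proots p = {#a#} + proots s"
    unfolding s using s0 by (subst proots_mult) auto
  have "degree p = Suc (degree s)"
    unfolding s using s0 by (subst degree_mult_eq) auto
  then have "s = (\<Prod>a\<in>#proots s. [:- a, 1:])"
    using Suc pr s0 by (intro Suc.hyps) auto
  then show ?case
    unfolding pr using s by (simp del: mult_pCons_left)
qed

lemma char_poly_eq_prod_sorted_eigenvalues:
  fixes A :: "real mat"
  assumes A: "A \<in> carrier_mat n n"
    and sym: "\<And>i j. i < n \<Longrightarrow> j < n \<Longrightarrow> A $$ (i, j) = A $$ (j, i)"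
  shows "char_poly A = (\<Prod>a\<leftarrow>sorted_eigenvalues A. [:- a, 1:])"
proof -
  have "size (proots (char_poly A)) = n"
    using length_sorted_eigenvalues[OF A sym]
    by (metis mset_sorted_list_of_multiset size_mset sorted_eigenvalues_def)
  then have "char_poly A = (\<Prod>a\<in>#proots (char_poly A). [:- a, 1:])"
    using degree_monic_char_poly[OF A] by (intro monic_split_eq_prod_proots) auto
  also have "\<dots> = (\<Prod>a\<leftarrow>sorted_eigenvalues A. [:- a, 1:])"
    unfolding sorted_eigenvalues_def
    by (simp flip: prod_mset_prod_list add: mset_map)
  finally show ?thesis .
qed

text \<open>
  The Householder reflection in the hyperplane orthogonal to \<open>v - e\<^sub>0\<close> exchanges \<open>v\<close> and \<open>e\<^sub>0\<close>.
\<close>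

lemma orthogonal_mat_with_first_col:
  fixes v :: "real vec"
  assumes v: "v \<in> carrier_vec n" "v \<bullet> v = 1" and n: "0 < n"
  obtains W where "W \<in> carrier_mat n n" "W\<^sup>T * W = 1\<^sub>m n" "W * W\<^sup>T = 1\<^sub>m n" "col W 0 = v"
proof -
  define u where "u i = v $ i - of_bool (i = 0)" for i
  define s where "s = (\<Sum>i<n. (u i)\<^sup>2)"
  define W where "W = mat n n (\<lambda>(i, j). of_bool (i = j) - 2 * u i * u j / s)"
  have W: "W \<in> carrier_mat n n" by (simp add: W_def)
  have WT: "W\<^sup>T = W" by (rule eq_matI) (auto simp: W_def)
  have WW: "W * W = 1\<^sub>m n"
  proof (rule eq_matI)
    fix i j assume "i < dim_row (1\<^sub>m n :: real mat)" "j < dim_col (1\<^sub>m n :: real mat)"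
    then have ij: "i < n" "j < n" by auto
    have "(W * W) $$ (i, j) = (\<Sum>k<n. (of_bool (i = k) - 2 * u i * u k / s) * (of_bool (k = j) - 2 * u k * u j / s))"
      using ij by (simp add: W_def scalar_prod_def atLeast0LessThan)
    also have "\<dots> = (\<Sum>k<n. (if k = i then of_bool (i = j) - 2 * u i * u j / s else 0)
         - (if k = j then 2 * u i * u j / s else 0) + (u k)\<^sup>2 * (4 * u i * u j / s\<^sup>2))"
      by (intro sum.cong refl) (auto simp: algebra_simps power2_eq_square)
    also have "\<dots> = of_bool (i = j) - 4 * u i * u j / s + s * (4 * u i * u j / s\<^sup>2)"
      using ij unfolding sum.distrib sum_subtractf sum_distrib_right[symmetric] s_def[symmetric] by simp
    also have "\<dots> = of_bool (i = j)" by (simp add: power2_eq_square)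
    finally show "(W * W) $$ (i, j) = 1\<^sub>m n $$ (i, j)" using ij by simp
  qed (simp_all add: W_def)
  have vv: "(\<Sum>i<n. (v $ i)\<^sup>2) = 1"
    using v by (simp add: scalar_prod_def atLeast0LessThan power2_eq_square)
  have "s = (\<Sum>i<n. (v $ i)\<^sup>2 + (if i = 0 then 1 - 2 * v $ 0 else 0))"
    unfolding s_def u_def by (intro sum.cong refl) (auto simp: power2_eq_square algebra_simps)
  then have s: "s = - 2 * u 0"
    using vv n by (simp add: sum.distrib u_def)
  have "col W 0 = v"
  proof (rule eq_vecI)
    fix i assume "i < dim_vec v"
    then have i: "i < n" using v by auto
    \<comment> \<open>If \<open>s = 0\<close>, then \<open>v = e\<^sub>0\<close>, and \<open>W\<close> is the identity because division by 0 gives 0.\<close>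
    have "2 * u i * u 0 / s = - u i"
    proof (cases "s = 0")
      case True
      then have "\<forall>i<n. u i = 0" unfolding s_def by (subst (asm) sum_nonneg_eq_0_iff) auto
      then show ?thesis using i by simp
    next
      case False
      then show ?thesis using s by (simp add: field_simps)
    qed
    then show "col W 0 $ i = v $ i" using i n by (simp add: W_def u_def)
  qed (use v W in auto)
  then show ?thesis using that W WT WW by simp
qed

text \<open>
  Conjugation with an orthogonal matrix whose first column is an eigenvector for the first entry \<open>e\<close>
  of the list makes the first column \<open>e\<close> times the first unit vector. The conjugate is still symmetric, so
  its first row has the same shape and it splits into the block \<open>e\<close> and a smaller symmetric matrix,
  to which the induction hypothesis applies. The order of the eigenvalues on the diagonal can be
  prescribed, which allows the use of the increasing order below.
\<close>

lemma real_symmetric_orthogonally_diagonalizable: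
  fixes A :: "real mat"
  assumes "A \<in> carrier_mat n n" and "A\<^sup>T = A"
    and "char_poly A = (\<Prod>a\<leftarrow>as. [:- a, 1:])"
  shows "\<exists>P. similar_mat_wit A (mat_diag n (\<lambda>i. as ! i)) P P\<^sup>T"
  using assms
proof (induction as arbitrary: n A)
  case Nil
  then have "n = 0" using degree_monic_char_poly[of A n] by simp
  then show ?case using Nil
    by (intro exI[of _ "1\<^sub>m 0"] similar_mat_witI[of _ _ 0]) (auto intro: eq_matI)
next
  case (Cons e as)
  let ?p = "\<Prod>a\<leftarrow>as. [:- a, 1:]"
  note A = Cons.prems(1)
  have cp: "char_poly A = [:- e, 1:] * ?p" using Cons.prems by simp
  have mon: "monic ?p" by (rule monic_prod_list) auto
  have "degree (char_poly A) = Suc (degree ?p)"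
    unfolding cp by (subst degree_mult_eq) (use mon in auto)
  then obtain m where n: "n = Suc m"
    using degree_monic_char_poly[OF A] by auto
  have "eigenvalue A e"
    unfolding eigenvalue_root_char_poly[OF A] cp by simp
  then obtain w where w: "w \<in> carrier_vec n" "w \<noteq> 0\<^sub>v n" "A *\<^sub>v w = e \<cdot>\<^sub>v w"
    using A unfolding eigenvalue_def eigenvector_def by auto
  have ww: "w \<bullet> w > 0"
    using w conjugate_square_greater_0_vec[of w n] by simp
  define v where "v = (1 / sqrt (w \<bullet> w)) \<cdot>\<^sub>v w"
  have v: "v \<in> carrier_vec n" "v \<bullet> v = 1" "A *\<^sub>v v = e \<cdot>\<^sub>v v"
    using w ww A
    by (auto simp: v_def mult_mat_vec smult_smult_assoc mult.commute)
  obtain W where W: "W \<in> carrier_mat n n" "W\<^sup>T * W = 1\<^sub>m n" "W * W\<^sup>T = 1\<^sub>m n" "col W 0 = v"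
    using orthogonal_mat_with_first_col[OF v(1,2)] n by auto
  have WT: "W\<^sup>T \<in> carrier_mat n n" using W by simp
  define B where "B = W\<^sup>T * A * W"
  have B: "B \<in> carrier_mat n n" using W A by (simp add: B_def)
  have BT: "B\<^sup>T = B"
    using W(1) A Cons.prems(2) by (simp add: B_def transpose_mult[of _ n n _ n] assoc_mult_mat[of _ n n _ n _ n])
  have AB: "similar_mat_wit A B W W\<^sup>T"
  proof (rule similar_mat_wit_sym, rule similar_mat_witI[of _ _ n])
  qed (use W A B in \<open>auto simp: B_def\<close>)
  have col0: "B $$ (i, 0) = (if i = 0 then e else 0)" if i: "i < n" for i
  proof -
    have "B $$ (i, 0) = (W\<^sup>T * (A * W)) $$ (i, 0)"
      using W A by (simp add: B_def assoc_mult_mat[of _ n n _ n _ n])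
    also have "\<dots> = col W i \<bullet> (A *\<^sub>v col W 0)"
      using W(1) A i n by (simp add: mult_mat_vec_def)
    also have "\<dots> = e * (col W i \<bullet> col W 0)"
      using W v i by (auto simp: scalar_prod_smult_distrib[of _ n])
    also have "col W i \<bullet> col W 0 = (W\<^sup>T * W) $$ (i, 0)"
      using W(1) i n by simp
    also have "\<dots> = of_bool (i = 0)" using i n unfolding W(2) by simp
    finally show ?thesis by simp
  qed
  define B3 where "B3 = mat m m (\<lambda>(i, j). B $$ (Suc i, Suc j))"
  have B3: "B3 \<in> carrier_mat m m" by (simp add: B3_def)
  have Bsym: "B $$ (i, j) = B $$ (j, i)" if "i < n" "j < n" for i j
    using that B BT by (metis carrier_matD index_transpose_mat(1))
  let ?E = "mat 1 1 (\<lambda>_. e)"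
  have block: "B = four_block_mat ?E (0\<^sub>m 1 m) (0\<^sub>m m 1) B3"
  proof (rule eq_matI)
    fix i j
    assume "i < dim_row (four_block_mat ?E (0\<^sub>m 1 m) (0\<^sub>m m 1) B3)"
      and "j < dim_col (four_block_mat ?E (0\<^sub>m 1 m) (0\<^sub>m m 1) B3)"
    then have ij: "i < n" "j < n" using n by (auto simp: B3_def)
    then show "B $$ (i, j) = four_block_mat ?E (0\<^sub>m 1 m) (0\<^sub>m m 1) B3 $$ (i, j)"
      using col0[of i] col0[of j] Bsym[of 0 j] n by (auto simp: B3_def)
  qed (use B n in \<open>auto simp: B3_def\<close>)
  have "char_poly B = char_poly ?E * char_poly B3"
    unfolding block by (rule char_poly_four_block_zeros_col[OF _ _ B3]) auto
  moreover have "char_poly ?E = [:- e, 1:]"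
    by (simp add: char_poly_defs det_def sign_def)
  moreover have "char_poly A = char_poly B"
    using AB char_poly_similar unfolding similar_mat_def by blast
  ultimately have "char_poly B3 = ?p"
    using cp by (metis mult_cancel_left pCons_eq_0_iff zero_neq_one)
  moreover have "B3\<^sup>T = B3"
    using Bsym n by (auto intro!: eq_matI simp: B3_def)
  ultimately obtain P where P: "similar_mat_wit B3 (mat_diag m (\<lambda>i. as ! i)) P P\<^sup>T"
    using Cons.IH[OF B3] by blast
  note Pd = similar_mat_witD2[OF B3 P]
  let ?P = "four_block_mat (1\<^sub>m 1) (0\<^sub>m 1 m) (0\<^sub>m m 1) P"
  let ?Q = "four_block_mat (1\<^sub>m 1) (0\<^sub>m 1 m) (0\<^sub>m m 1) (P\<^sup>T)"
  let ?D = "four_block_mat ?E (0\<^sub>m 1 m) (0\<^sub>m m 1) (mat_diag m (\<lambda>i. as ! i))"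
  have BD: "similar_mat_wit B ?D ?P ?Q"
    unfolding block
    by (rule similar_mat_wit_four_block[OF similar_mat_wit_refl P _ _ _ B3]) (use Pd in auto)
  have D: "?D = mat_diag n (\<lambda>i. (e # as) ! i)"
    by (rule eq_matI) (auto simp: n mat_diag_def nth_Cons')
  have "?Q * W\<^sup>T = (W * ?P)\<^sup>T"
  proof -
    have "?P \<in> carrier_mat n n" using Pd n by auto
    moreover have "?Q = ?P\<^sup>T"
      using Pd by (subst transpose_four_block_mat[of _ 1 1 _ m _ m]) auto
    ultimately show ?thesis using W(1) by (simp add: transpose_mult[of _ n n _ n])
  qed
  then show ?case
    using similar_mat_wit_trans[OF AB BD] unfolding D by metis
qed

section \<open>Comparison of eigenvalues\<close>

definition quadratic_form :: "'v set \<Rightarrow> ('v \<Rightarrow> 'v \<Rightarrow> real) \<Rightarrow> ('v \<Rightarrow> real) \<Rightarrow> real" where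
  "quadratic_form V M f = (\<Sum>u\<in>V. \<Sum>v\<in>V. M u v * f u * f v)"

text \<open>
  Gaussian elimination: an equation in which the unknown \<open>f w\<close> occurs is solved for it, and
  substitution into the others leaves one equation and one unknown less.
\<close>

lemma nontrivial_solution_if_fewer_equations:
  fixes a :: "'j \<Rightarrow> 'v \<Rightarrow> 'a::field"
  assumes "finite J" "finite V" "card J < card V"
  shows "\<exists>f. (\<exists>v\<in>V. f v \<noteq> 0) \<and> (\<forall>j\<in>J. (\<Sum>v\<in>V. a j v * f v) = 0)"
  using assms
proof (induction J arbitrary: V a rule: finite_induct)
  case empty
  then have "V \<noteq> {}" by auto
  then show ?case by (intro exI[of _ "\<lambda>_. 1"]) auto
next
  case (insert j J V a)
  show ?case
  proof (cases "\<exists>w\<in>V. a j w \<noteq> 0")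
    case False
    then show ?thesis using insert.IH[of V a] insert.prems insert.hyps by auto
  next
    case True
    then obtain w where w: "w \<in> V" "a j w \<noteq> 0" by auto
    define b where "b i v = a i v - a i w * a j v / a j w" for i v
    have "card J < card (V - {w})" using insert w by simp
    then obtain f where f: "\<exists>v\<in>V - {w}. f v \<noteq> 0" "\<forall>i\<in>J. (\<Sum>v\<in>V - {w}. b i v * f v) = 0"
      using insert.IH[of "V - {w}" b] insert.prems by auto
    define g where "g = f(w := - (\<Sum>v\<in>V - {w}. a j v * f v) / a j w)"
    have sum: "(\<Sum>v\<in>V. a i v * g v) =
        a i w * g w + (\<Sum>v\<in>V - {w}. a i v * f v)" for i
      using w insert.prems by (subst sum.remove[of _ w]) (auto simp: g_def intro!: sum.cong)
    have "(\<Sum>v\<in>V. a j v * g v) = 0"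
      unfolding sum using w by (simp add: g_def)
    moreover have "(\<Sum>v\<in>V. a i v * g v) = 0" if "i \<in> J" for i
    proof -
      have "(\<Sum>v\<in>V - {w}. b i v * f v) =
          (\<Sum>v\<in>V - {w}. a i v * f v) - a i w / a j w * (\<Sum>v\<in>V - {w}. a j v * f v)"
        by (simp add: b_def algebra_simps sum_subtractf sum_distrib_left)
      then show ?thesis unfolding sum using f(2) that by (simp add: g_def)
    qed
    moreover have "\<exists>v\<in>V. g v \<noteq> 0" using f(1) by (auto simp: g_def)
    ultimately show ?thesis by blast
  qed
qed

text \<open>
  The functions \<open>p i\<close> are an orthonormal eigenbasis, and the inner products with them are the
  coordinates of \<open>f\<close>. The min-max argument uses the eigenbasis only through Parseval's identity and
  the diagonal form of the quadratic form in these coordinates.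
\<close>

lemma symmetric_kernel_eigenbasis:
  fixes M :: "'v \<Rightarrow> 'v \<Rightarrow> real"
  assumes vs: "distinct vs" and sym: "\<And>u v. M u v = M v u"
  obtains p :: "nat \<Rightarrow> 'v \<Rightarrow> real"
  where "\<And>f. (\<Sum>v\<in>set vs. (f v)\<^sup>2) = (\<Sum>i<length vs. (\<Sum>v\<in>set vs. p i v * f v)\<^sup>2)"
    and "\<And>f. quadratic_form (set vs) M f =
      (\<Sum>i<length vs. sorted_eigenvalues (matrix_wrt vs M) ! i * (\<Sum>v\<in>set vs. p i v * f v)\<^sup>2)"
proof -
  define n where "n = length vs"
  define A where "A = matrix_wrt vs M"
  define l where "l i = sorted_eigenvalues A ! i" for i
  have A: "A \<in> carrier_mat n n" by (simp add: A_def n_def)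
  have Aij: "A $$ (i, j) = M (vs ! i) (vs ! j)" if "i < n" "j < n" for i j
    using that by (simp add: A_def n_def matrix_wrt_def)
  have As: "A $$ (i, j) = A $$ (j, i)" if "i < n" "j < n" for i j
    using that Aij sym by metis
  have "A\<^sup>T = A" using A As by (auto intro!: eq_matI)
  then obtain P where P: "similar_mat_wit A (mat_diag n l) P P\<^sup>T"
    using real_symmetric_orthogonally_diagonalizable[OF A _ char_poly_eq_prod_sorted_eigenvalues[OF A As]]
    unfolding l_def by blast
  note Pd = similar_mat_witD2[OF A P]
  have Pc: "P \<in> carrier_mat n n" using Pd by auto
  have PP: "(\<Sum>k<n. P $$ (i, k) * P $$ (j, k)) = of_bool (i = j)" if "i < n" "j < n" for i j
  proof -
    have "(\<Sum>k<n. P $$ (i, k) * P $$ (j, k)) = (P * P\<^sup>T) $$ (i, j)"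
      using that Pc by (simp add: scalar_prod_def atLeast0LessThan)
    then show ?thesis using that Pd by simp
  qed
  have PDP: "A $$ (i, j) = (\<Sum>k<n. l k * P $$ (i, k) * P $$ (j, k))" if "i < n" "j < n" for i j
  proof -
    have "A $$ (i, j) = (P * mat_diag n l * P\<^sup>T) $$ (i, j)" by (simp only: Pd)
    also have "\<dots> = (\<Sum>k<n. l k * P $$ (i, k) * P $$ (j, k))"
      unfolding mat_diag_mult_right[OF Pc]
      using that Pc by (simp add: scalar_prod_def atLeast0LessThan mult_ac)
    finally show ?thesis .
  qed
  have bij: "bij_betw ((!) vs) {..<n} (set vs)"
    using vs by (simp add: n_def bij_betw_nth)
  have sum_vs: "(\<Sum>v\<in>set vs. g v) = (\<Sum>i<n. g (vs ! i))" for g :: "'v \<Rightarrow> real"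
    using sum.reindex_bij_betw[OF bij, of g] by simp
  define p where "p i v = P $$ (the_inv_into {..<n} ((!) vs) v, i)" for i v
  have p: "p k (vs ! i) = P $$ (i, k)" if "i < n" for i k
    using that bij by (simp add: p_def the_inv_into_f_f bij_betw_def)
  define c where "c f k = (\<Sum>i<n. P $$ (i, k) * f (vs ! i))" for f k
  have c: "(\<Sum>v\<in>set vs. p k v * f v) = c f k" for f k
    unfolding sum_vs c_def using p by simp
  have expand: "(\<Sum>k<n. w k * (c f k)\<^sup>2) =
      (\<Sum>i<n. \<Sum>j<n. (\<Sum>k<n. w k * P $$ (i, k) * P $$ (j, k)) * (f (vs ! i) * f (vs ! j)))"
    for w f
  proof -
    have "(\<Sum>k<n. w k * (c f k)\<^sup>2) = (\<Sum>k<n. \<Sum>i<n. \<Sum>j<n.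
        w k * P $$ (i, k) * P $$ (j, k) * (f (vs ! i) * f (vs ! j)))"
      unfolding c_def power2_eq_square sum_product
      by (simp add: sum_distrib_left mult_ac)
    also have "\<dots> = (\<Sum>i<n. \<Sum>k<n. \<Sum>j<n.
        w k * P $$ (i, k) * P $$ (j, k) * (f (vs ! i) * f (vs ! j)))"
      by (rule sum.swap)
    also have "\<dots> = (\<Sum>i<n. \<Sum>j<n. \<Sum>k<n.
        w k * P $$ (i, k) * P $$ (j, k) * (f (vs ! i) * f (vs ! j)))"
      by (intro sum.cong refl sum.swap)
    finally show ?thesis by (simp add: sum_distrib_right)
  qed
  show ?thesis
  proof (rule that[of p])
    fix f :: "'v \<Rightarrow> real"
    have "(\<Sum>k<n. (c f k)\<^sup>2) = (\<Sum>i<n. \<Sum>j<n. of_bool (i = j) * (f (vs ! i) * f (vs ! j)))"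
      using expand[of "\<lambda>_. 1" f] PP by simp
    also have "\<dots> = (\<Sum>i<n. \<Sum>j<n. if j = i then (f (vs ! i))\<^sup>2 else 0)"
      by (intro sum.cong refl) (auto simp: power2_eq_square)
    also have "\<dots> = (\<Sum>i<n. (f (vs ! i))\<^sup>2)" by simp
    finally show "(\<Sum>v\<in>set vs. (f v)\<^sup>2) = (\<Sum>i<length vs. (\<Sum>v\<in>set vs. p i v * f v)\<^sup>2)"
      unfolding c n_def[symmetric] sum_vs by simp
    have "(\<Sum>k<n. l k * (c f k)\<^sup>2) = (\<Sum>i<n. \<Sum>j<n. A $$ (i, j) * (f (vs ! i) * f (vs ! j)))"
      using expand[of l f] PDP by simp
    also have "\<dots> = quadratic_form (set vs) M f"
      unfolding quadratic_form_def sum_vs by (simp add: Aij mult_ac)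
    finally show "quadratic_form (set vs) M f =
        (\<Sum>i<length vs. sorted_eigenvalues (matrix_wrt vs M) ! i * (\<Sum>v\<in>set vs. p i v * f v)\<^sup>2)"
      unfolding c n_def[symmetric] l_def A_def by simp
  qed
qed

text \<open>
  If \<open>f\<close> has no coordinates above the index \<open>i + h\<close> in the eigenbasis of \<open>M\<close>, and \<open>Tf f\<close> has none
  below \<open>i\<close> in that of \<open>N\<close>, then with \<open>\<mu>\<close> and \<open>\<nu>\<close> for the two eigenvalues in the conclusion
  \<open>\<nu> \<parallel>Tf f\<parallel>\<^sup>2 \<le> N(Tf f) \<le> M(f) \<le> \<mu> \<parallel>f\<parallel>\<^sup>2 \<le> \<mu> \<parallel>Tf f\<parallel>\<^sup>2\<close>.
  The last step needs \<open>\<mu> \<ge> 0\<close>, which follows from \<open>0 \<le> M(f) \<le> \<mu> \<parallel>f\<parallel>\<^sup>2\<close>. Such an \<open>f \<noteq> 0\<close>, subject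
  also to the \<open>h\<close> equations \<open>\<phi>\<close>, exists because with \<open>n\<close> unknowns there are
  \<open>(n - i - h - 1) + i + h = n - 1\<close> equations.
\<close>

theorem sorted_eigenvalues_comparison:
  fixes M :: "'v \<Rightarrow> 'v \<Rightarrow> real" and N :: "'w \<Rightarrow> 'w \<Rightarrow> real"
    and T :: "'w \<Rightarrow> 'v \<Rightarrow> real" and \<phi> :: "'k \<Rightarrow> 'v \<Rightarrow> real"
    and vs :: "'v list" and ws :: "'w list"
  defines "Tf \<equiv> \<lambda>f w. \<Sum>v\<in>set vs. T w v * f v"
  assumes vs: "distinct vs" and M: "\<And>u v. M u v = M v u"
    and ws: "distinct ws" and N: "\<And>u v. N u v = N v u"
    and K: "finite K" "card K = h"
    and i: "i < length ws" "i + h < length vs"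
    and norm: "\<And>f. (\<forall>k\<in>K. (\<Sum>v\<in>set vs. \<phi> k v * f v) = 0) \<Longrightarrow>
      (\<Sum>v\<in>set vs. (f v)\<^sup>2) \<le> (\<Sum>w\<in>set ws. (Tf f w)\<^sup>2)"
    and form: "\<And>f. (\<forall>k\<in>K. (\<Sum>v\<in>set vs. \<phi> k v * f v) = 0) \<Longrightarrow>
      quadratic_form (set ws) N (Tf f) \<le> quadratic_form (set vs) M f"
    and nonneg: "\<And>f. 0 \<le> quadratic_form (set vs) M f"
  shows "sorted_eigenvalues (matrix_wrt ws N) ! i \<le> sorted_eigenvalues (matrix_wrt vs M) ! (i + h)"
proof -
  define lM where "lM = sorted_eigenvalues (matrix_wrt vs M)"
  define lN where "lN = sorted_eigenvalues (matrix_wrt ws N)"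
  have len: "length lM = length vs" "length lN = length ws"
    unfolding lM_def lN_def
    by (rule length_sorted_eigenvalues; auto simp: matrix_wrt_def intro: M N)+
  have sorted: "sorted lM" "sorted lN"
    unfolding lM_def lN_def sorted_eigenvalues_def by simp_all
  obtain p where p: "\<And>f. (\<Sum>v\<in>set vs. (f v)\<^sup>2) = (\<Sum>j<length vs. (\<Sum>v\<in>set vs. p j v * f v)\<^sup>2)"
    "\<And>f. quadratic_form (set vs) M f = (\<Sum>j<length vs. lM ! j * (\<Sum>v\<in>set vs. p j v * f v)\<^sup>2)"
    by (rule symmetric_kernel_eigenbasis[of vs M, folded lM_def, OF vs M], rule that)
  obtain q where q: "\<And>f. (\<Sum>w\<in>set ws. (f w)\<^sup>2) = (\<Sum>j<length ws. (\<Sum>w\<in>set ws. q j w * f w)\<^sup>2)"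
    "\<And>f. quadratic_form (set ws) N f = (\<Sum>j<length ws. lN ! j * (\<Sum>w\<in>set ws. q j w * f w)\<^sup>2)"
    by (rule symmetric_kernel_eigenbasis[of ws N, folded lN_def, OF ws N], rule that)
  define Phi where "Phi = \<phi> ` K \<union> p ` {i + h<..<length vs} \<union>
    (\<lambda>j v. \<Sum>w\<in>set ws. q j w * T w v) ` {..<i}"
  have fin: "finite Phi" using K by (simp add: Phi_def)
  have "card Phi \<le> card (\<phi> ` K) + card (p ` {i + h<..<length vs}) +
      card ((\<lambda>j v. \<Sum>w\<in>set ws. q j w * T w v) ` {..<i})"
    unfolding Phi_def by (meson add_right_mono card_Un_le order_trans)
  also have "\<dots> \<le> h + (length vs - Suc (i + h)) + i"
    using K card_image_le[of K \<phi>] card_image_le[of "{i + h<..<length vs}" p]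
      card_image_le[of "{..<i}" "\<lambda>j v. \<Sum>w\<in>set ws. q j w * T w v"] by auto
  also have "\<dots> < card (set vs)" using i vs by (simp add: distinct_card)
  finally obtain f where f: "\<exists>v\<in>set vs. f v \<noteq> 0"
    and zero: "\<And>g. g \<in> Phi \<Longrightarrow> (\<Sum>v\<in>set vs. g v * f v) = 0"
    using nontrivial_solution_if_fewer_equations[of Phi "set vs" "\<lambda>g. g"] fin by auto
  have phi0: "\<forall>k\<in>K. (\<Sum>v\<in>set vs. \<phi> k v * f v) = 0"
    using zero by (simp add: Phi_def)
  have high: "(\<Sum>v\<in>set vs. p j v * f v) = 0" if "i + h < j" "j < length vs" for j
    using zero that by (simp add: Phi_def)
  have low: "(\<Sum>w\<in>set ws. q j w * Tf f w) = 0" if "j < i" for j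
  proof -
    have "(\<Sum>w\<in>set ws. q j w * Tf f w) = (\<Sum>v\<in>set vs. (\<Sum>w\<in>set ws. q j w * T w v) * f v)"
      unfolding Tf_def sum_distrib_left sum_distrib_right
      by (subst sum.swap) (simp add: mult_ac)
    also have "\<dots> = 0" using that by (intro zero) (auto simp: Phi_def)
    finally show ?thesis .
  qed
  define F where "F = (\<Sum>v\<in>set vs. (f v)\<^sup>2)"
  define G where "G = (\<Sum>w\<in>set ws. (Tf f w)\<^sup>2)"
  have "F > 0" unfolding F_def using f by (auto intro!: sum_pos2)
  have FG: "F \<le> G" unfolding F_def G_def by (rule norm[OF phi0])
  have lower: "lN ! i * G \<le> quadratic_form (set ws) N (Tf f)"
    unfolding G_def q sum_distrib_left
  proof (rule sum_mono)
    fix j assume "j \<in> {..<length ws}"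
    then show "lN ! i * (\<Sum>w\<in>set ws. q j w * Tf f w)\<^sup>2 \<le> lN ! j * (\<Sum>w\<in>set ws. q j w * Tf f w)\<^sup>2"
      using low[of j] len sorted_nth_mono[OF sorted(2), of i j]
      by (cases "j < i") (auto intro: mult_right_mono)
  qed
  have upper: "quadratic_form (set vs) M f \<le> lM ! (i + h) * F"
    unfolding F_def p sum_distrib_left
  proof (rule sum_mono)
    fix j assume "j \<in> {..<length vs}"
    then show "lM ! j * (\<Sum>v\<in>set vs. p j v * f v)\<^sup>2 \<le> lM ! (i + h) * (\<Sum>v\<in>set vs. p j v * f v)\<^sup>2"
      using high[of j] len i sorted_nth_mono[OF sorted(1), of j "i + h"]
      by (cases "i + h < j") (auto intro: mult_right_mono)
  qed
  have "0 \<le> lM ! (i + h) * F" using nonneg[of f] upper by linarith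
  then have "0 \<le> lM ! (i + h)" using \<open>F > 0\<close> by (simp add: zero_le_mult_iff)
  then have "lM ! (i + h) * F \<le> lM ! (i + h) * G" using FG by (rule mult_left_mono[rotated])
  then have "lN ! i * G \<le> lM ! (i + h) * G"
    using lower upper form[OF phi0] by linarith
  then show ?thesis using \<open>F > 0\<close> FG unfolding lM_def lN_def by simp
qed

section \<open>The energy of a function on a multigraph\<close>

text \<open>
  Loops disappear from the energy: their contributions to the degree and to the diagonal weight
  cancel. For any other edge, the two ordered pairs of its end points contribute
  \<open>(f a)\<^sup>2 - f a * f b\<close> and \<open>(f b)\<^sup>2 - f b * f a\<close>, which add up to the square.
\<close>

lemma quadratic_form_laplacian:
  assumes G: "finite_multigraph G"
    and ends: "\<And>e. e \<in> edges G \<Longrightarrow> ends G e = Upair (s e) (t e)"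
  shows "quadratic_form (verts G) (laplacian G \<epsilon>) f = (\<Sum>e\<in>edges G. \<epsilon> e * (f (s e) - f (t e))\<^sup>2)"
proof -
  have fin: "finite (verts G)" "finite (edges G)"
    and st: "\<And>e. e \<in> edges G \<Longrightarrow> s e \<in> verts G \<and> t e \<in> verts G"
    using G ends by (fastforce simp: finite_multigraph_def)+
  let ?w = "weight_between G \<epsilon>"
  let ?V = "verts G"
  have w: "?w u v = (\<Sum>e\<in>edges G. if ends G e = Upair u v then if u = v then 2 * \<epsilon> e else \<epsilon> e else 0)" for u v
    unfolding weight_between_def using fin by (simp add: sum.inter_filter)
  have "quadratic_form ?V (laplacian G \<epsilon>) f =
      (\<Sum>u\<in>?V. \<Sum>v\<in>?V. (if v = u then weighted_degree G \<epsilon> u * (f u)\<^sup>2 else 0) - ?w u v * f u * f v)"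
    unfolding quadratic_form_def laplacian_def
    by (intro sum.cong refl) (auto simp: algebra_simps power2_eq_square)
  also have "\<dots> = (\<Sum>u\<in>?V. \<Sum>v\<in>?V. ?w u v * ((f u)\<^sup>2 - f u * f v))"
    using fin by (simp add: sum_subtractf weighted_degree_def sum_distrib_left sum_distrib_right algebra_simps)
  also have "\<dots> = (\<Sum>u\<in>?V. \<Sum>v\<in>?V. \<Sum>e\<in>edges G. if ends G e = Upair u v then \<epsilon> e * ((f u)\<^sup>2 - f u * f v) else 0)"
    unfolding w sum_distrib_right
    by (intro sum.cong refl) (auto simp: power2_eq_square)
  also have "\<dots> = (\<Sum>e\<in>edges G. \<Sum>u\<in>?V. \<Sum>v\<in>?V. if ends G e = Upair u v then \<epsilon> e * ((f u)\<^sup>2 - f u * f v) else 0)"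
    by (subst sum.swap[of _ "edges G"], intro sum.cong refl sum.swap)
  also have "\<dots> = (\<Sum>e\<in>edges G. \<epsilon> e * (f (s e) - f (t e))\<^sup>2)"
  proof (intro sum.cong refl)
    fix e assume e: "e \<in> edges G"
    let ?g = "\<lambda>u v. \<epsilon> e * ((f u)\<^sup>2 - f u * f v)"
    \<comment> \<open>For a loop, both summands on the right-hand side select the same pair, but there \<open>?g\<close> is 0.\<close>
    have "(\<Sum>u\<in>?V. \<Sum>v\<in>?V. if ends G e = Upair u v then ?g u v else 0) =
        (\<Sum>u\<in>?V. \<Sum>v\<in>?V. (if u = s e then if v = t e then ?g u v else 0 else 0)
          + (if u = t e then if v = s e then ?g u v else 0 else 0))"
      using ends[OF e] by (intro sum.cong refl) (auto simp: power2_eq_square)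
    also have "\<dots> = ?g (s e) (t e) + ?g (t e) (s e)"
    proof -
      have "(\<Sum>u\<in>?V. \<Sum>v\<in>?V. if u = a then if v = b then ?g u v else 0 else 0) = ?g a b"
        if "a \<in> ?V" "b \<in> ?V" for a b
      proof -
        have "(\<Sum>u\<in>?V. \<Sum>v\<in>?V. if u = a then if v = b then ?g u v else 0 else 0) =
            (\<Sum>u\<in>?V. if u = a then ?g u b else 0)"
          using that fin by (intro sum.cong refl) auto
        then show ?thesis using that fin by simp
      qed
      then show ?thesis using st[OF e] by (simp only: sum.distrib)
    qed
    also have "\<dots> = \<epsilon> e * (f (s e) - f (t e))\<^sup>2"
      by (simp add: power2_eq_square algebra_simps)
    finally show "(\<Sum>u\<in>?V. \<Sum>v\<in>?V. if ends G e = Upair u v then ?g u v else 0) =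
        \<epsilon> e * (f (s e) - f (t e))\<^sup>2" .
  qed
  finally show ?thesis .
qed

lemma quadratic_form_laplacian_nonneg:
  assumes "weighted_multigraph G \<epsilon>"
  shows "0 \<le> quadratic_form (verts G) (laplacian G \<epsilon>) f"
proof -
  have "\<exists>s t. ends G e = Upair s t" for e by (cases "ends G e") auto
  then obtain s t where "\<And>e. ends G e = Upair (s e) (t e)" by metis
  then show ?thesis
    using assms quadratic_form_laplacian[of G s t \<epsilon> f]
    by (auto simp: weighted_multigraph_def less_imp_le intro!: sum_nonneg)
qed

lemma weighted_multigraph_quotient:
  assumes "weighted_multigraph G \<epsilon>" "equiv (verts G) r"
  shows "weighted_multigraph (quotient_multigraph G r) \<epsilon>"
  using assms finite_multigraph_quotient[of G r]
  by (simp add: weighted_multigraph_def quotient_multigraph_def)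

text \<open>
  The quotient keeps the edges and replaces their end points by the classes of these, so the two
  energies agree edge by edge.
\<close>

lemma quadratic_form_laplacian_pullback:
  fixes f :: "'v set \<Rightarrow> real"
  assumes G: "finite_multigraph G" and r: "equiv (verts G) r"
  shows "quadratic_form (verts G) (laplacian G \<epsilon>) (\<lambda>v. f (r `` {v})) =
    quadratic_form (verts G // r) (laplacian (quotient_multigraph G r) \<epsilon>) f"
proof -
  have "\<exists>s t. ends G e = Upair s t" for e by (cases "ends G e") auto
  then obtain s t where st: "\<And>e. ends G e = Upair (s e) (t e)" by metis
  then have "ends (quotient_multigraph G r) e = Upair (r `` {s e}) (r `` {t e})" for e
    by (simp add: quotient_multigraph_def)
  from quadratic_form_laplacian[OF finite_multigraph_quotient[OF G r] this, of \<epsilon> f]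
  show ?thesis
    using quadratic_form_laplacian[OF G st, of \<epsilon>] by (simp add: quotient_multigraph_def)
qed

lemma quadratic_form_cong:
  "(\<And>v. v \<in> V \<Longrightarrow> f v = g v) \<Longrightarrow> quadratic_form V M f = quadratic_form V M g"
  by (simp add: quadratic_form_def)

lemma laplacian_eigenvalue_enumeration:
  assumes "finite (verts G)"
  obtains vs where "distinct vs" "set vs = verts G" "length vs = card (verts G)"
    "\<And>i. laplacian_eigenvalue G \<epsilon> i = sorted_eigenvalues (matrix_wrt vs (laplacian G \<epsilon>)) ! (i - 1)"
proof -
  define vs where "vs = (SOME vs. distinct vs \<and> set vs = verts G)"
  have "distinct vs \<and> set vs = verts G"
    unfolding vs_def by (rule someI_ex) (use finite_distinct_list[OF assms] in blast)
  then show ?thesis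
    using that[of vs] distinct_card[of vs]
    by (simp add: laplacian_eigenvalue_def laplacian_mat_def vs_def)
qed

section \<open>Eigenvalues of the quotient\<close>

lemma equiv_class_singleton:
  assumes V: "finite V" and r: "equiv V r" and v: "v \<in> V" "\<not> card (r `` {v}) > 1"
  shows "r `` {v} = {v}"
proof -
  have self: "v \<in> r `` {v}" using r v(1) by (rule equiv_class_self)
  have "finite (r `` {v})"
    using r V by (auto simp: equiv_def refl_on_def intro: finite_subset)
  then have "card (r `` {v}) = 1"
    using v(2) self card_gt_0_iff[of "r `` {v}"] by (auto simp: not_less)
  then obtain x where "r `` {v} = {x}" by (rule card_1_singletonE)
  with self show ?thesis by (metis singletonD)
qed

lemma finite_quotient_equiv: "finite V \<Longrightarrow> equiv V r \<Longrightarrow> finite (V // r)"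
  by (simp add: equiv_type finite_quotient)

lemma card_Diff_add_card:
  assumes "finite A" "B \<subseteq> A"
  shows "card (A - B) + card B = card A"
  using assms by (metis card_Diff_subset card_mono finite_subset le_add_diff_inverse2)

text \<open>
  The vertices outside of nontrivial classes correspond to the singleton classes.
\<close>

lemma card_union_nontrivial_classes:
  assumes V: "finite V" and r: "equiv V r"
  shows "card {v \<in> V. card (r `` {v}) > 1} + card (V // r) = card V + card {C \<in> V // r. card C > 1}"
proof -
  let ?K = "{v \<in> V. card (r `` {v}) > 1}"
  have fin: "finite (V // r)" using V r by (rule finite_quotient_equiv)
  have singleton: "r `` {v} = {v}" if "v \<in> V - ?K" for v
    using that by (intro equiv_class_singleton[OF V r]) auto
  have "(V // r) - {C \<in> V // r. card C > 1} = (\<lambda>v. {v}) ` (V - ?K)"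
  proof (intro equalityI subsetI)
    fix C assume C: "C \<in> (V // r) - {C \<in> V // r. card C > 1}"
    then obtain v where v: "v \<in> V" "C = r `` {v}" by (auto elim: quotientE)
    with C have "v \<in> V - ?K" by auto
    with singleton[OF this] v(2) show "C \<in> (\<lambda>v. {v}) ` (V - ?K)" by (intro image_eqI[of _ _ v]) (simp_all only:)
  next
    fix C assume "C \<in> (\<lambda>v. {v}) ` (V - ?K)"
    then obtain v where v: "v \<in> V - ?K" "C = {v}" by auto
    then have "C = r `` {v}" using singleton[OF v(1)] by (simp only:)
    then have "C \<in> V // r" using v(1) by (auto intro: quotientI)
    then show "C \<in> (V // r) - {C \<in> V // r. card C > 1}" using v(2) by simp
  qed
  then have "card ((V // r) - {C \<in> V // r. card C > 1}) = card (V - ?K)"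
    by (simp add: card_image)
  moreover have "card ((V // r) - {C \<in> V // r. card C > 1}) + card {C \<in> V // r. card C > 1} = card (V // r)"
    using fin by (intro card_Diff_add_card) auto
  moreover have "card (V - ?K) + card ?K = card V"
    using V by (intro card_Diff_add_card) auto
  ultimately show ?thesis by linarith
qed

context
  fixes G :: "('v, 'e) multigraph" and \<epsilon> :: "'e \<Rightarrow> real" and r :: "('v \<times> 'v) set"
  assumes G: "weighted_multigraph G \<epsilon>" and r: "equiv (verts G) r"
begin

text \<open>
  The comparison theorem for the pull-back along the projection, without side conditions.
\<close>

lemma laplacian_eigenvalue_le_quotient:
  assumes i: "i \<in> {1..card (verts G // r)}"
  shows "laplacian_eigenvalue G \<epsilon> i \<le> laplacian_eigenvalue (quotient_multigraph G r) \<epsilon> i"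
proof -
  let ?H = "quotient_multigraph G r"
  have finG: "finite_multigraph G" using G by (simp add: weighted_multigraph_def)
  have V: "finite (verts G)" using finG by (simp add: finite_multigraph_def)
  have VH: "verts ?H = verts G // r" by (simp add: quotient_multigraph_def)
  have fin: "finite (verts G // r)" using V r by (rule finite_quotient_equiv)
  obtain vs where vs: "distinct vs" "set vs = verts G" "length vs = card (verts G)"
    "\<And>i. laplacian_eigenvalue G \<epsilon> i = sorted_eigenvalues (matrix_wrt vs (laplacian G \<epsilon>)) ! (i - 1)"
    by (rule laplacian_eigenvalue_enumeration[OF V, where \<epsilon> = \<epsilon>], rule that)
  obtain cs where cs: "distinct cs" "set cs = verts ?H" "length cs = card (verts ?H)"
    "\<And>i. laplacian_eigenvalue ?H \<epsilon> i = sorted_eigenvalues (matrix_wrt cs (laplacian ?H \<epsilon>)) ! (i - 1)"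
    by (rule laplacian_eigenvalue_enumeration[of ?H \<epsilon>], simp add: VH fin, rule that)
  have le: "card (verts G // r) \<le> card (verts G)"
  proof -
    have "verts G // r = (\<lambda>v. r `` {v}) ` verts G" by (auto simp: quotient_def)
    then show ?thesis using V by (simp add: card_image_le)
  qed
  define T :: "'v \<Rightarrow> 'v set \<Rightarrow> real" where "T v C = of_bool (C = r `` {v})" for v C
  have T: "(\<Sum>C\<in>verts G // r. T v C * f C) = f (r `` {v})" if "v \<in> verts G" for v f
  proof -
    have "(\<Sum>C\<in>verts G // r. T v C * f C) = (\<Sum>C\<in>verts G // r. if C = r `` {v} then f C else 0)"
      by (intro sum.cong refl) (simp add: T_def)
    then show ?thesis using that fin by (simp add: quotientI)
  qed
  have "sorted_eigenvalues (matrix_wrt vs (laplacian G \<epsilon>)) ! (i - 1)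
      \<le> sorted_eigenvalues (matrix_wrt cs (laplacian ?H \<epsilon>)) ! (i - 1 + 0)"
  proof (rule sorted_eigenvalues_comparison[where T = T and K = "{}" and \<phi> = "\<lambda>_ _. 0"])
    fix f :: "'v set \<Rightarrow> real"
    show "0 \<le> quadratic_form (set cs) (laplacian ?H \<epsilon>) f"
      using quadratic_form_laplacian_nonneg[OF weighted_multigraph_quotient[OF G r]] cs by simp
    have "quadratic_form (verts G) (laplacian G \<epsilon>) (\<lambda>v. \<Sum>C\<in>verts G // r. T v C * f C) =
        quadratic_form (verts G // r) (laplacian ?H \<epsilon>) f"
      using quadratic_form_laplacian_pullback[OF finG r]
      by (subst quadratic_form_cong[OF T])
    then show "quadratic_form (set vs) (laplacian G \<epsilon>) (\<lambda>v. \<Sum>C\<in>set cs. T v C * f C)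
        \<le> quadratic_form (set cs) (laplacian ?H \<epsilon>) f"
      using vs cs VH by simp
    have "(\<Sum>C\<in>verts G // r. (f C)\<^sup>2) = (\<Sum>C\<in>(\<lambda>v. r `` {v}) ` verts G. (f C)\<^sup>2)"
      by (rule sum.cong) (auto simp: quotient_def)
    also have "\<dots> \<le> (\<Sum>v\<in>verts G. (f (r `` {v}))\<^sup>2)"
      using V sum_image_le[of "verts G" "\<lambda>C. (f C)\<^sup>2" "\<lambda>v. r `` {v}"] by (simp add: o_def)
    also have "\<dots> = (\<Sum>v\<in>verts G. (\<Sum>C\<in>verts G // r. T v C * f C)\<^sup>2)"
      by (simp add: T)
    finally show "(\<Sum>C\<in>set cs. (f C)\<^sup>2) \<le> (\<Sum>v\<in>set vs. (\<Sum>C\<in>set cs. T v C * f C)\<^sup>2)"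
      using vs cs VH by simp
  qed (use i vs cs VH le laplacian_sym in auto)
  then show ?thesis by (simp add: vs cs)
qed

text \<open>
  The comparison theorem for the map that sends \<open>f\<close> to the function with value \<open>f v\<close> at a singleton
  class \<open>{v}\<close> and \<open>0\<close> at all other classes, under the side conditions that \<open>f\<close> vanishes on the
  nontrivial classes. On this subspace, \<open>f\<close> is the pull-back of its image.
\<close>

lemma quotient_laplacian_eigenvalue_le:
  defines "h \<equiv> card {v \<in> verts G. card (r `` {v}) > 1}"
  assumes i: "i \<in> {1..card (verts G // r)}" and ih: "i + h \<le> card (verts G)"
  shows "laplacian_eigenvalue (quotient_multigraph G r) \<epsilon> i \<le> laplacian_eigenvalue G \<epsilon> (i + h)"
proof -
  let ?H = "quotient_multigraph G r"
  let ?K = "{v \<in> verts G. card (r `` {v}) > 1}"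
  have finG: "finite_multigraph G" using G by (simp add: weighted_multigraph_def)
  have V: "finite (verts G)" using finG by (simp add: finite_multigraph_def)
  have VH: "verts ?H = verts G // r" by (simp add: quotient_multigraph_def)
  have fin: "finite (verts G // r)" using V r by (rule finite_quotient_equiv)
  obtain vs where vs: "distinct vs" "set vs = verts G" "length vs = card (verts G)"
    "\<And>i. laplacian_eigenvalue G \<epsilon> i = sorted_eigenvalues (matrix_wrt vs (laplacian G \<epsilon>)) ! (i - 1)"
    by (rule laplacian_eigenvalue_enumeration[OF V, where \<epsilon> = \<epsilon>], rule that)
  obtain cs where cs: "distinct cs" "set cs = verts ?H" "length cs = card (verts ?H)"
    "\<And>i. laplacian_eigenvalue ?H \<epsilon> i = sorted_eigenvalues (matrix_wrt cs (laplacian ?H \<epsilon>)) ! (i - 1)"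
    by (rule laplacian_eigenvalue_enumeration[of ?H \<epsilon>], simp add: VH fin, rule that)
  define T :: "'v set \<Rightarrow> 'v \<Rightarrow> real" where "T C v = of_bool (C = {v})" for C v
  define Tf where "Tf = (\<lambda>f C. \<Sum>v\<in>verts G. T C v * f v)"
  have Tf_class: "Tf f (r `` {v}) = f v" if v: "v \<in> verts G" and f: "\<forall>u\<in>?K. f u = 0" for f v
  proof (cases "v \<in> ?K")
    case True
    have "r `` {v} \<noteq> {u}" for u using True by auto
    then show ?thesis using True f by (simp add: Tf_def T_def)
  next
    case False
    then have "r `` {v} = {v}" using v by (intro equiv_class_singleton[OF V r]) auto
    then have "Tf f (r `` {v}) = (\<Sum>u\<in>verts G. if u = v then f u else 0)"
      unfolding Tf_def by (intro sum.cong refl) (auto simp: T_def)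
    then show ?thesis using v V by simp
  qed
  define \<phi> :: "'v \<Rightarrow> 'v \<Rightarrow> real" where "\<phi> u v = of_bool (v = u)" for u v
  have \<phi>: "(\<Sum>v\<in>verts G. \<phi> u v * f v) = f u" if "u \<in> verts G" for u f
  proof -
    have "(\<Sum>v\<in>verts G. \<phi> u v * f v) = (\<Sum>v\<in>verts G. if v = u then f v else 0)"
      by (intro sum.cong refl) (simp add: \<phi>_def)
    then show ?thesis using that V by simp
  qed
  have "sorted_eigenvalues (matrix_wrt cs (laplacian ?H \<epsilon>)) ! (i - 1)
      \<le> sorted_eigenvalues (matrix_wrt vs (laplacian G \<epsilon>)) ! (i - 1 + h)"
  proof (rule sorted_eigenvalues_comparison[where T = T and K = ?K and \<phi> = \<phi>])
    fix f :: "'v \<Rightarrow> real"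
    show "0 \<le> quadratic_form (set vs) (laplacian G \<epsilon>) f"
      using quadratic_form_laplacian_nonneg[OF G] vs by simp
  next
    fix f :: "'v \<Rightarrow> real"
    assume "\<forall>u\<in>?K. (\<Sum>v\<in>set vs. \<phi> u v * f v) = 0"
    then have f: "\<forall>u\<in>?K. f u = 0" using vs \<phi> by simp
    have "quadratic_form (verts G // r) (laplacian ?H \<epsilon>) (Tf f) =
        quadratic_form (verts G) (laplacian G \<epsilon>) f"
      unfolding quadratic_form_laplacian_pullback[OF finG r, symmetric]
      by (rule quadratic_form_cong) (rule Tf_class[OF _ f])
    then show "quadratic_form (set cs) (laplacian ?H \<epsilon>) (\<lambda>C. \<Sum>v\<in>set vs. T C v * f v)
        \<le> quadratic_form (set vs) (laplacian G \<epsilon>) f"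
      using vs cs VH by (simp add: Tf_def)
    have "(\<Sum>v\<in>verts G. (f v)\<^sup>2) = (\<Sum>v\<in>verts G - ?K. (f v)\<^sup>2)"
      using f V by (intro sum.mono_neutral_right) auto
    also have "\<dots> = (\<Sum>v\<in>verts G - ?K. (Tf f (r `` {v}))\<^sup>2)"
      using Tf_class[OF _ f] by simp
    also have "\<dots> = (\<Sum>C\<in>(\<lambda>v. r `` {v}) ` (verts G - ?K). (Tf f C)\<^sup>2)"
    proof (rule sum.reindex[symmetric, unfolded o_def])
      have "inj_on (\<lambda>v. {v}) (verts G - ?K)" by simp
      then show "inj_on (\<lambda>v. r `` {v}) (verts G - ?K)"
        by (rule inj_on_cong[THEN iffD1, rotated]) (auto intro!: equiv_class_singleton[OF V r, symmetric])
    qed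
    also have "\<dots> \<le> (\<Sum>C\<in>verts G // r. (Tf f C)\<^sup>2)"
      using fin by (intro sum_mono2) (auto intro: quotientI)
    finally show "(\<Sum>v\<in>set vs. (f v)\<^sup>2) \<le> (\<Sum>C\<in>set cs. (\<Sum>v\<in>set vs. T C v * f v)\<^sup>2)"
      using vs cs VH by (simp add: Tf_def)
  qed (use i ih vs cs VH V laplacian_sym in \<open>auto simp: h_def\<close>)
  moreover have "i - 1 + h = i + h - 1" using i by simp
  ultimately show ?thesis by (simp add: vs cs)
qed

end

theorem corollary5p8:
  fixes G :: "('v, 'e) multigraph"
    and \<epsilon> :: "'e \<Rightarrow> real"
    and r :: "('v \<times> 'v) set"
    and n k q :: nat
    and lam mu :: "nat \<Rightarrow> real"
  assumes "weighted_multigraph G \<epsilon>"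
    and "card (verts G) = n"
    and "equiv (verts G) r"
    and "k \<le> n" and "card (verts G // r) = n - k"
    and "q = card {C \<in> verts G // r. card C > 1}"
    and "lam = laplacian_eigenvalue G \<epsilon>"
    and "mu = laplacian_eigenvalue (quotient_multigraph G r) \<epsilon>"
  shows "\<forall>i\<in>{1..n - k}. lam i \<le> mu i \<and> (i + q + k \<le> n \<longrightarrow> mu i \<le> lam (i + q + k))"
proof -
  have "finite (verts G)"
    using assms(1) by (simp add: weighted_multigraph_def finite_multigraph_def)
  from card_union_nontrivial_classes[OF this assms(3)]
  have "card {v \<in> verts G. card (r `` {v}) > 1} = q + k"
    using assms by linarith
  then show ?thesis
    using laplacian_eigenvalue_le_quotient[OF assms(1,3)]
      quotient_laplacian_eigenvalue_le[OF assms(1,3)] assms(2,5,7,8)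
    by (auto simp: add.assoc)
qed

end
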